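(* Let $z^\star\in\mathbb{T}^n$, let $\Delta\in\mathbb{C}^{n\times n}$ be a Hermitian matrix with zero diagonal, and let $C=(z^\star)(z^\star)^H+\Delta$. Suppose that (i) $\|\Delta\|_{\rm op}\le\frac{n^{3/4}}{312}$ and $\|\Delta z^\star\|_\infty\le\frac{n}{24}$, and (ii) $\alpha\in\left[4,\frac{n}{\|\Delta\|_{\rm op}}\right)$. Let $\tilde C=C+\frac{n}{\alpha}I$, and for $z\in\mathbb{T}^n$ define $$ \Sigma(z)={\rm Diag}(|\tilde Cz|)-\tilde C,\qquad \rho(z)=\|\Sigma(z)z\|_2=\left\|\left({\rm Diag}(|\tilde Cz|)-\tilde C\right)z\right\|_2. $$ Then, for any point $z\in\mathbb{T}^n$ satisfying $d_2(z,z^\star)\le\frac{\sqrt n}{2}$ and any global maximizer $\hat z\in\mathbb{T}^n$ of $w\mapsto w^HCw$ over $\mathbb{T}^n$, we have $$ d_2(z,\hat z)\le\frac{8}{n}\rho(z). $$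
   Context: $\mathbb{T}^n=\{w\in\mathbb{C}^n: |w_1|=\cdots=|w_n|=1\}$; $(\cdot)^H$ is the Hermitian transpose; $\|\cdot\|_{\rm op}$ is the operator norm; $n/0$ is read as $+\infty$. For $v\in\mathbb{C}^n$, $|v|$ is the vector of entrywise moduli and ${\rm Diag}(v)$ is the diagonal matrix with diagonal $v$. For $w,z\in\mathbb{T}^n$, $d_2(w,z)=\min_{\theta\in[0,2\pi)}\|w-e^{i\theta}z\|_2$. *)

theory Defs
  imports "HOL-Analysis.Analysis"
begin

definition torus :: "(complex ^ 'n) set" where
  "torus = {w. \<forall>i. norm (w $ i) = 1}"

definition hermitian_transpose :: "complex ^ 'n ^ 'm \<Rightarrow> complex ^ 'm ^ 'n" where
  "hermitian_transpose A = (\<chi> i j. cnj (A $ j $ i))"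

definition hermitian :: "complex ^ 'n ^ 'n \<Rightarrow> bool" where
  "hermitian A \<longleftrightarrow> hermitian_transpose A = A"

text \<open>The scalar \<open>u\<^sup>H v\<close>, conjugate-linear in the first argument, and the matrix \<open>u v\<^sup>H\<close>.
  Mind that \<open>\<bullet>\<close> on \<^typ>\<open>complex ^ 'n\<close> is only the real part of \<open>u\<^sup>H v\<close>.\<close>

definition hdot :: "complex ^ 'n \<Rightarrow> complex ^ 'n \<Rightarrow> complex" where
  "hdot u v = (\<Sum>i\<in>UNIV. cnj (u $ i) * v $ i)"

definition houter :: "complex ^ 'm \<Rightarrow> complex ^ 'n \<Rightarrow> complex ^ 'n ^ 'm" where
  "houter u v = (\<chi> i j. u $ i * cnj (v $ j))"

definition Diag :: "complex ^ 'n \<Rightarrow> complex ^ 'n ^ 'n" where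
  "Diag v = (\<chi> i j. if i = j then v $ i else 0)"

definition cmod_vec :: "complex ^ 'n \<Rightarrow> complex ^ 'n" where
  "cmod_vec v = (\<chi> i. complex_of_real (norm (v $ i)))"

text \<open>The library's \<^const>\<open>infnorm\<close> treats \<^typ>\<open>complex ^ 'n\<close> as a real space and takes the
  maximum over real and imaginary parts, so it is not the maximum of the moduli.\<close>

definition linf_norm :: "complex ^ 'n \<Rightarrow> real" where
  "linf_norm v = Max (range (\<lambda>i. norm (v $ i)))"

definition op_norm :: "complex ^ 'n ^ 'm \<Rightarrow> real" where
  "op_norm A = onorm ((*v) A)"

definition d2 :: "complex ^ 'n \<Rightarrow> complex ^ 'n \<Rightarrow> real" where
  "d2 w z = (INF \<theta>\<in>{0..<2*pi}. norm (w - cis \<theta> *s z))"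

definition Sigma_mat :: "complex ^ 'n ^ 'n \<Rightarrow> complex ^ 'n \<Rightarrow> complex ^ 'n ^ 'n" where
  "Sigma_mat A z = Diag (cmod_vec (A *v z)) - A"

definition rho :: "complex ^ 'n ^ 'n \<Rightarrow> complex ^ 'n \<Rightarrow> real" where
  "rho A z = norm (Sigma_mat A z *v z)"

text \<open>The infimum defining \<^const>\<open>d2\<close> is a minimum.\<close>

lemma d2_attained:
  "\<exists>\<theta>\<in>{0..<2*pi}. d2 w z = norm (w - cis \<theta> *s z)"
    "\<theta> \<in> {0..<2*pi} \<Longrightarrow> d2 w z \<le> norm (w - cis \<theta> *s z)"
proof -
  let ?f = "\<lambda>\<theta>. norm (w - cis \<theta> *s z)"
  have eq: "cis \<theta> *s z = (\<chi> i. cis \<theta> * z $ i)" for \<theta>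
    by (simp add: vector_scalar_mult_def)
  have "continuous_on {0..2*pi} ?f"
    unfolding eq by (intro continuous_intros continuous_on_vec_lambda)
  then obtain t where t: "t \<in> {0..2*pi}" "\<And>s. s \<in> {0..2*pi} \<Longrightarrow> ?f t \<le> ?f s"
    using continuous_attains_inf[of "{0..2*pi}" ?f] by auto
  define r where "r = (if t = 2*pi then 0 else t)"
  have r: "r \<in> {0..<2*pi}" "?f r = ?f t"
    using t(1) by (auto simp: r_def)
  have "d2 w z = ?f r"
    unfolding d2_def using r t(2) by (intro cInf_eq_minimum imageI) auto
  then show "\<exists>\<theta>\<in>{0..<2*pi}. d2 w z = ?f \<theta>"
    using r(1) by blast
  show "d2 w z \<le> ?f \<theta>" if "\<theta> \<in> {0..<2*pi}"
    using that t(2)[of \<theta>] r(2) \<open>d2 w z = ?f r\<close> by simp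
qed

text \<open>The quadratic form of a Hermitian matrix is real-valued, so maximizing its real part is
  maximizing the form itself.\<close>

lemma hermitian_form_real:
  assumes "hermitian A"
  shows "complex_of_real (Re (hdot w (A *v w))) = hdot w (A *v w)"
proof -
  have A: "cnj (A $ i $ j) = A $ j $ i" for i j
  proof -
    have "hermitian_transpose A $ j $ i = A $ j $ i"
      using assms by (simp add: hermitian_def)
    then show ?thesis by (simp add: hermitian_transpose_def)
  qed
  have e: "hdot w (A *v w) = (\<Sum>i\<in>UNIV. \<Sum>j\<in>UNIV. cnj (w $ i) * A $ i $ j * w $ j)"
    by (simp add: hdot_def matrix_vector_mult_def sum_distrib_left mult.assoc)
  have "cnj (hdot w (A *v w)) = (\<Sum>i\<in>UNIV. \<Sum>j\<in>UNIV. w $ i * A $ j $ i * cnj (w $ j))"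
    by (simp add: e A)
  also have "\<dots> = hdot w (A *v w)"
    unfolding e by (subst sum.swap) (simp add: mult_ac)
  finally show ?thesis
    by (simp add: complex_eq_iff)
qed

end

theory Submission
  imports Defs
begin

text \<open>
  Rotate \<open>z\<close> and \<open>zstar\<close> by phases to \<open>z'\<close> and \<open>y\<close> whose inner products with \<open>zhat\<close> are
  nonnegative; this changes neither \<open>C\<close> nor \<open>rho\<close>. Put \<open>e = z' - zhat\<close>.
  Comparing the objective at \<open>zhat\<close> and \<open>y\<close> gives \<open>sqrt n * norm (zhat - y) \<le> 4 * op_norm \<Delta>\<close>,
  and optimality of \<open>zhat\<close> in each coordinate gives \<open>C zhat = |C zhat| zhat\<close>.
  Subtracting the fixed-point equation of \<open>zhat\<close> splits \<open>Sigma(z') z'\<close> into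
  \<open>|C zhat| e\<close>, \<open>(|Ct z'| - |Ct zhat|) z'\<close> and \<open>- C e\<close> (entrywise products), since the shift
  by \<open>n/\<alpha>\<close> cancels in \<open>Sigma(zhat)\<close>. The first term has norm at least about
  \<open>(1 - 1/24) n * norm e\<close>, the other two at most \<open>norm (Ct e)\<close> and \<open>norm (C e)\<close>.
  As \<open>zhat\<^sup>H e = - (norm e)\<^sup>2 / 2\<close> by alignment and \<open>norm e\<close> is at most about \<open>sqrt n / 2\<close>,
  \<open>norm (C e)\<close> is at most about \<open>n/4 * norm e\<close>, and the shift adds at most \<open>n/4 * norm e\<close>
  because \<open>\<alpha> \<ge> 4\<close>. What remains exceeds \<open>n/8 * norm e\<close>.
\<close>

section \<open>Complex inner product and phase alignment\<close>

lemma inner_eq_Re_hdot: "x \<bullet> y = Re (hdot x y)"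
  by (simp add: inner_vec_def inner_complex_def hdot_def)

lemma hdot_scale_right: "hdot x (c *s y) = c * hdot x y"
  by (simp add: hdot_def sum_distrib_left mult_ac)

lemma hdot_diff_left: "hdot (x - y) w = hdot x w - hdot y w"
  by (simp add: hdot_def sum_subtractf algebra_simps)

lemma hdot_diff_right: "hdot w (x - y) = hdot w x - hdot w y"
  by (simp add: hdot_def sum_subtractf algebra_simps)

lemma hdot_self: "hdot x x = complex_of_real ((norm x)\<^sup>2)"
  unfolding power2_norm_eq_inner inner_eq_Re_hdot
  by (simp add: hdot_def complex_eq_iff mult.commute)

lemma cnj_hdot: "cnj (hdot x y) = hdot y x"
  by (simp add: hdot_def mult.commute)

lemma norm_scale_vec: "norm (c *s (x :: complex ^ 'n)) = norm c * norm x"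
  by (simp add: norm_vec_def norm_mult L2_set_right_distrib)

text \<open>The witness is the conjugate phase of \<open>hdot x y\<close>. This is how
  representatives modulo a global phase are chosen below.\<close>

lemma hdot_phase_alignment:
  obtains c where "norm c = 1" "hdot x (c *s y) = complex_of_real (norm (hdot x y))"
proof (cases "hdot x y = 0")
  case True
  then show ?thesis
    by (intro that[of 1]) (auto simp: hdot_scale_right)
next
  case False
  let ?c = "cnj (sgn (hdot x y))"
  have "norm ?c = 1"
    using False by (simp add: norm_sgn)
  moreover have "?c * hdot x y = complex_of_real (norm (hdot x y))"
    using False by (simp add: sgn_eq complex_norm_square[symmetric] field_simps power2_eq_square)
  ultimately show ?thesis
    by (intro that[of ?c]) (simp_all only: hdot_scale_right)
qed

text \<open>After alignment the modulus is a real inner product, so real Cauchy-Schwarz gives the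
  complex one.\<close>

lemma norm_hdot_le: "norm (hdot x y) \<le> norm x * norm y"
proof -
  obtain c where c: "norm c = 1" "hdot x (c *s y) = complex_of_real (norm (hdot x y))"
    by (rule hdot_phase_alignment)
  have "norm (hdot x y) = x \<bullet> (c *s y)"
    by (simp add: inner_eq_Re_hdot c)
  also have "\<dots> \<le> norm x * norm y"
    using norm_cauchy_schwarz[of x "c *s y"] by (simp add: norm_scale_vec c)
  finally show ?thesis .
qed

lemma houter_vector_mult: "houter u v *v x = hdot v x *s u"
  by (simp add: vec_eq_iff houter_def matrix_vector_mult_def hdot_def sum_distrib_left mult_ac)

lemma houter_scale:
  assumes "norm c = 1"
  shows "houter (c *s u) (c *s v) = houter u v"
proof -
  have "c * cnj c = 1"
    using assms complex_norm_square[of c] by simp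
  moreover have "c * p * (cnj c * q) = (c * cnj c) * (p * q)" for p q
    by (simp only: mult_ac)
  ultimately show ?thesis
    by (simp add: vec_eq_iff houter_def)
qed

section \<open>Hermitian matrices and norm bounds\<close>

lemma hermitian_nth:
  assumes "hermitian A"
  shows "cnj (A $ i $ j) = A $ j $ i"
proof -
  have "hermitian_transpose A $ j $ i = A $ j $ i"
    using assms by (simp add: hermitian_def)
  then show ?thesis
    by (simp add: hermitian_transpose_def)
qed

lemma hermitian_hdot:
  assumes "hermitian A"
  shows "hdot x (A *v y) = hdot (A *v x) y"
proof -
  have "hdot x (A *v y) = (\<Sum>i\<in>UNIV. \<Sum>j\<in>UNIV. cnj (x $ i) * (A $ i $ j * y $ j))"
    by (simp add: hdot_def matrix_vector_mult_def sum_distrib_left)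
  also have "\<dots> = (\<Sum>j\<in>UNIV. \<Sum>i\<in>UNIV. cnj (x $ i) * (A $ i $ j * y $ j))"
    by (rule sum.swap)
  also have "\<dots> = hdot (A *v x) y"
    by (simp add: hdot_def matrix_vector_mult_def sum_distrib_right sum_distrib_left
        hermitian_nth[OF assms] mult_ac)
  finally show ?thesis .
qed

lemma hermitian_inner:
  assumes "hermitian A"
  shows "x \<bullet> (A *v y) = (A *v x) \<bullet> y"
  by (simp add: inner_eq_Re_hdot hermitian_hdot[OF assms])

lemma hermitian_houter_add:
  assumes "hermitian A"
  shows "hermitian (houter u u + A)"
  by (simp add: hermitian_def hermitian_transpose_def houter_def vec_eq_iff hermitian_nth[OF assms])

lemma vector_mult_scaleR: "A *v (r *\<^sub>R x) = r *\<^sub>R (A *v (x :: complex ^ 'n))"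
  by (simp add: vec_eq_iff matrix_vector_mult_def scaleR_sum_right)

lemma norm_matrix_vector_le:
  fixes A :: "complex ^ 'n ^ 'm"
  shows "norm (A *v x) \<le> op_norm A * norm x"
proof -
  have "linear ((*v) A)"
    by (intro linearI) (simp_all add: matrix_vector_right_distrib vector_mult_scaleR)
  then show ?thesis
    unfolding op_norm_def by (intro onorm linear_conv_bounded_linear[THEN iffD1])
qed

lemma op_norm_nonneg: "0 \<le> op_norm (A :: complex ^ 'n ^ 'm)"
proof -
  have "linear ((*v) A)"
    by (intro linearI) (simp_all add: matrix_vector_right_distrib vector_mult_scaleR)
  then show ?thesis
    unfolding op_norm_def by (intro onorm_pos_le linear_conv_bounded_linear[THEN iffD1])
qed

lemma norm_nth_le_linf_norm: "norm (v $ i) \<le> linf_norm v"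
  unfolding linf_norm_def by (rule Max_ge) auto

section \<open>Geometry of the torus modulo a global phase\<close>

lemma norm2_torus:
  assumes "(w :: complex ^ 'n) \<in> torus"
  shows "(norm w)\<^sup>2 = real CARD('n)"
proof -
  have "w \<bullet> w = (\<Sum>i::'n\<in>UNIV. 1)"
    unfolding inner_vec_def
  proof (rule sum.cong)
    fix i
    have "norm (w $ i) = 1"
      using assms by (simp add: torus_def)
    then show "w $ i \<bullet> w $ i = 1"
      using power2_norm_eq_inner[of "w $ i"] by simp
  qed simp
  then show ?thesis
    by (simp add: power2_norm_eq_inner)
qed

lemma norm_torus: "(w :: complex ^ 'n) \<in> torus \<Longrightarrow> norm w = sqrt (real CARD('n))"
  by (metis norm2_torus norm_ge_zero real_sqrt_unique)

lemma norm2_diff_torus: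
  assumes "(w :: complex ^ 'n) \<in> torus" "z \<in> torus"
  shows "(norm (w - z))\<^sup>2 = 2 * real CARD('n) - 2 * Re (hdot w z)"
  using norm2_torus[OF assms(1)] norm2_torus[OF assms(2)]
  by (simp add: power2_norm_eq_inner inner_diff_left inner_diff_right inner_eq_Re_hdot[of w z, symmetric]
      inner_commute)

lemma torus_scale: "norm c = 1 \<Longrightarrow> w \<in> torus \<Longrightarrow> c *s w \<in> torus"
  by (simp add: torus_def norm_mult)

lemma d2_le_norm:
  assumes "norm c = 1"
  shows "d2 w z \<le> norm (w - c *s z)"
proof -
  have "c = cis (Arg2pi c)"
    using Arg2pi_eq[of c] assms by (simp add: cis_conv_exp)
  moreover have "Arg2pi c \<in> {0..<2*pi}"
    using Arg2pi_ge_0 Arg2pi_lt_2pi by simp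
  ultimately show ?thesis
    using d2_attained(2)[of "Arg2pi c" w z] by simp
qed

text \<open>On the torus the distance decreases as \<open>Re (hdot w z)\<close> grows. This real
  part is at most the modulus, which ignores phases, and alignment attains it.\<close>

lemma norm_aligned_diff_le:
  fixes w z :: "complex ^ 'n"
  assumes "w \<in> torus" "z \<in> torus" "hdot w z = complex_of_real (norm (hdot w z))" "norm c = 1"
  shows "norm (w - z) \<le> norm (w - c *s z)"
proof (rule power2_le_imp_le)
  have "Re (hdot w (c *s z)) \<le> norm (hdot w (c *s z))"
    by (rule complex_Re_le_cmod)
  also have "\<dots> = Re (hdot w z)"
    by (subst assms(3)) (simp add: hdot_scale_right norm_mult assms(4))
  finally show "(norm (w - z))\<^sup>2 \<le> (norm (w - c *s z))\<^sup>2"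
    using norm2_diff_torus[OF assms(1,2)] norm2_diff_torus[OF assms(1) torus_scale[OF assms(4,2)]]
    by simp
qed simp

lemma rho_scale:
  assumes "norm c = 1"
  shows "rho A (c *s z) = rho A z"
proof -
  have "cmod_vec (A *v (c *s z)) = cmod_vec (A *v z)"
    by (simp add: cmod_vec_def vec_eq_iff vector_scalar_commute norm_mult assms)
  then show ?thesis
    by (simp add: rho_def Sigma_mat_def vector_scalar_commute norm_scale_vec assms)
qed

section \<open>Consequences of optimality and a lower bound for \<open>rho\<close>\<close>

lemma Diag_vector_mult_nth: "(Diag v *v x) $ i = v $ i * x $ i"
  by (simp add: Diag_def matrix_vector_mult_def if_distrib if_distribR cong: if_cong)

text \<open>When only coordinate \<open>i\<close> varies over the unit circle, the diagonal term of
  the form is constant and the rest is linear in that coordinate. So \<open>x $ i\<close> must point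
  along the off-diagonal part \<open>g\<close> of \<open>(A *v x) $ i\<close>; the nonnegative
  diagonal entry adds a multiple in the same direction.\<close>

lemma maximizer_fixed_point:
  fixes A :: "complex ^ 'n ^ 'n"
  assumes "hermitian A" "0 \<le> Re (A $ i $ i)"
    and max: "is_arg_max (\<lambda>w. Re (hdot w (A *v w))) (\<lambda>w. w \<in> torus) x"
  shows "(A *v x) $ i = complex_of_real (norm ((A *v x) $ i)) * x $ i"
proof -
  define r where "r = Re (A $ i $ i)"
  have Aii: "A $ i $ i = complex_of_real r"
    using hermitian_nth[OF assms(1), of i i] by (simp add: r_def complex_eq_iff)
  define g where "g = (A *v x) $ i - r * x $ i"
  have x: "x \<in> torus" and nx: "norm (x $ i) = 1"
    using max by (auto simp: is_arg_max_def torus_def)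
  have opt: "Re (cnj u * g) \<le> Re (cnj (x $ i) * g)" if u: "norm u = 1" for u
  proof -
    define t where "t = u - x $ i"
    define w where "w = x + axis i t"
    have w: "w \<in> torus"
      using x u by (auto simp: torus_def w_def t_def axis_def)
    have hl: "hdot (axis i t) v = cnj t * v $ i" for v :: "complex ^ 'n"
      by (simp add: hdot_def axis_def if_distrib if_distribR cong: if_cong)
    have Aax: "(A *v axis i t) $ i = r * t"
      by (simp add: matrix_vector_mult_def axis_def if_distrib if_distribR Aii cong: if_cong)
    have "w \<bullet> (A *v w) \<le> x \<bullet> (A *v x)"
      using max w by (auto simp: is_arg_max_def inner_eq_Re_hdot not_less)
    moreover have "w \<bullet> (A *v w) = x \<bullet> (A *v x) + 2 * (axis i t \<bullet> (A *v x)) + axis i t \<bullet> (A *v axis i t)"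
      using hermitian_inner[OF assms(1), of x "axis i t"]
      by (simp add: w_def inner_add_left inner_add_right matrix_vector_right_distrib inner_commute)
    moreover have "axis i t \<bullet> (A *v x) = Re (cnj t * (A *v x) $ i)"
      "axis i t \<bullet> (A *v axis i t) = Re (cnj t * (r * t))"
      by (simp_all add: inner_eq_Re_hdot[of "axis i t"] hl Aax)
    ultimately have le: "2 * Re (cnj t * (A *v x) $ i) + Re (cnj t * (r * t)) \<le> 0"
      by linarith
    have "(Re u)\<^sup>2 + (Im u)\<^sup>2 = 1" "(Re (x $ i))\<^sup>2 + (Im (x $ i))\<^sup>2 = 1"
      using u nx cmod_power2[of u] cmod_power2[of "x $ i"] by simp_all
    then have sq: "r * (Re u)\<^sup>2 + r * (Im u)\<^sup>2 = r" "r * (Re (x $ i))\<^sup>2 + r * (Im (x $ i))\<^sup>2 = r"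
      by (metis distrib_left mult.right_neutral)+
    \<comment> \<open>The terms in \<open>r\<close> cancel: for unit \<open>u\<close> and
      \<open>x $ i\<close>, the square of \<open>norm t\<close> is
      \<open>- 2 * Re (cnj t * x $ i)\<close>.\<close>
    have "2 * Re (cnj t * (A *v x) $ i) + Re (cnj t * (r * t))
        = 2 * (Re (cnj u * g) - Re (cnj (x $ i) * g))"
      using sq unfolding t_def g_def by (simp add: power2_eq_square algebra_simps)
    with le show ?thesis
      by simp
  qed
  have g: "g = norm g * x $ i"
  proof (cases "g = 0")
    case False
    \<comment> \<open>Testing optimality with \<open>u = sgn g\<close> forces equality in
      Cauchy-Schwarz.\<close>
    have "norm (sgn g) = 1"
      using False by (simp add: norm_sgn)
    moreover have "cnj (sgn g) * g = norm g"
      using False by (simp add: sgn_eq complex_norm_square[symmetric] field_simps power2_eq_square)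
    ultimately have "norm g \<le> x $ i \<bullet> g"
      using opt[of "sgn g"] by (simp add: inner_complex_def)
    then have "x $ i \<bullet> g = norm (x $ i) * norm g"
      using norm_cauchy_schwarz[of "x $ i" g] nx by simp
    then show ?thesis
      using norm_cauchy_schwarz_eq[of "x $ i" g] nx by (simp add: scaleR_conv_of_real)
  qed simp
  have eq: "(A *v x) $ i = complex_of_real (r + norm g) * x $ i"
    using g by (simp add: g_def algebra_simps)
  have "norm ((A *v x) $ i) = r + norm g"
    using assms(2) by (simp only: eq norm_mult nx norm_of_real) (simp add: r_def)
  with eq show ?thesis
    by simp
qed

text \<open>With \<open>s = norm (hdot x y)\<close>, optimality bounds n^2 - s^2 by the difference
  of the two \<open>\<Delta>\<close>-forms, which factors through \<open>x - y\<close> and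
  \<open>x + y\<close>. The left side is at least n (n - s), half of n times the squared distance,
  so one factor \<open>norm (x - y)\<close> cancels.\<close>

lemma maximizer_error_bound:
  fixes x y :: "complex ^ 'n"
  assumes "y \<in> torus" "hermitian \<Delta>" "C = houter y y + \<Delta>"
    and max: "is_arg_max (\<lambda>w. Re (hdot w (C *v w))) (\<lambda>w. w \<in> torus) x"
    and al: "hdot x y = complex_of_real (norm (hdot x y))"
  shows "sqrt (real CARD('n)) * norm (x - y) \<le> 4 * op_norm \<Delta>"
proof -
  let ?n = "real CARD('n)"
  define s where "s = norm (hdot x y)"
  have s: "0 \<le> s" "hdot x y = s" "hdot y x = s"
    using al cnj_hdot[of x y] by (auto simp: s_def) (metis complex_cnj_complex_of_real)
  have x: "x \<in> torus"
    using max by (auto simp: is_arg_max_def)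
  have d: "(norm (x - y))\<^sup>2 = 2 * (?n - s)"
    using norm2_diff_torus[OF x assms(1)] s by simp
  have C: "w \<bullet> (C *v w) = (norm (hdot y w))\<^sup>2 + w \<bullet> (\<Delta> *v w)" for w
  proof -
    have "hdot w (hdot y w *s y) = complex_of_real ((norm (hdot y w))\<^sup>2)"
      using complex_norm_square[of "hdot y w"] by (simp add: hdot_scale_right cnj_hdot)
    then have "w \<bullet> (hdot y w *s y) = (norm (hdot y w))\<^sup>2"
      by (simp add: inner_eq_Re_hdot)
    then show ?thesis
      by (simp add: assms(3) matrix_vector_mult_add_rdistrib inner_add_right houter_vector_mult)
  qed
  have "y \<bullet> (C *v y) \<le> x \<bullet> (C *v x)"
    using max assms(1) by (auto simp: is_arg_max_def inner_eq_Re_hdot not_less)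
  then have "?n\<^sup>2 + y \<bullet> (\<Delta> *v y) \<le> s\<^sup>2 + x \<bullet> (\<Delta> *v x)"
    using s norm2_torus[OF assms(1)] by (simp add: C hdot_self)
  moreover have "x \<bullet> (\<Delta> *v x) - y \<bullet> (\<Delta> *v y) = (x - y) \<bullet> (\<Delta> *v (x + y))"
    using hermitian_inner[OF assms(2), of x y]
    by (simp add: matrix_vector_right_distrib inner_add_right inner_diff_left inner_commute[of "\<Delta> *v x"])
  moreover have "\<dots> \<le> norm (x - y) * (op_norm \<Delta> * norm (x + y))"
    by (meson norm_cauchy_schwarz norm_matrix_vector_le mult_left_mono norm_ge_zero order_trans)
  moreover have "norm (x - y) * (op_norm \<Delta> * norm (x + y))
      \<le> norm (x - y) * (op_norm \<Delta> * (2 * sqrt ?n))"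
    using norm_triangle_ineq[of x y] norm_torus[OF x] norm_torus[OF assms(1)]
    by (intro mult_left_mono op_norm_nonneg) auto
  ultimately have 1: "(?n + s) * (?n - s) \<le> norm (x - y) * (op_norm \<Delta> * (2 * sqrt ?n))"
    by (simp add: power2_eq_square algebra_simps)
  have "0 \<le> ?n - s"
    using zero_le_power2[of "norm (x - y)"] unfolding d by simp
  then have "?n * (?n - s) \<le> (?n + s) * (?n - s)"
    using s by (intro mult_right_mono) auto
  from order_trans[OF this 1] have "?n * (norm (x - y))\<^sup>2 \<le> norm (x - y) * (op_norm \<Delta> * (4 * sqrt ?n))"
    unfolding d by (simp add: algebra_simps)
  moreover have "?n * (norm (x - y))\<^sup>2
      = (sqrt ?n * norm (x - y)) * (sqrt ?n * norm (x - y))"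
    by (simp add: power2_eq_square)
  ultimately have "(sqrt ?n * norm (x - y)) * (sqrt ?n * norm (x - y))
      \<le> (sqrt ?n * norm (x - y)) * (4 * op_norm \<Delta>)"
    by (simp add: algebra_simps)
  then show ?thesis
    using op_norm_nonneg[of \<Delta>] by (cases "norm (x - y) = 0") auto
qed

lemma rho_ge:
  fixes x z :: "complex ^ 'n"
  assumes "z \<in> torus" and fp: "\<And>i. (A *v x) $ i = complex_of_real (norm ((A *v x) $ i)) * x $ i"
    and x: "x \<in> torus" and m: "\<And>i. m \<le> norm ((A *v x) $ i)" and "0 \<le> m" "0 \<le> b"
  shows "m * norm (z - x) - norm (A *v (z - x)) - norm (A *v (z - x) + b *\<^sub>R (z - x))
    \<le> rho (A + b *\<^sub>R mat 1) z"
proof -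
  let ?B = "A + b *\<^sub>R mat 1"
  define e where "e = z - x"
  have B: "?B *v v = A *v v + b *\<^sub>R v" for v
  proof -
    have "(b *\<^sub>R mat 1) *v v = b *\<^sub>R v"
      by (simp add: vec_eq_iff matrix_vector_mult_def mat_def if_distrib if_distribR
          cong: if_cong)
    then show ?thesis
      by (simp add: matrix_vector_mult_add_rdistrib)
  qed
  \<comment> \<open>\<open>A *v x\<close> is a nonnegative entrywise multiple of \<open>x\<close>,
    so adding \<open>b *\<^sub>R x\<close> raises each modulus by exactly \<open>b\<close>.\<close>
  have nB: "norm ((?B *v x) $ i) = norm ((A *v x) $ i) + b" for i
  proof -
    have "(?B *v x) $ i = complex_of_real (norm ((A *v x) $ i) + b) * x $ i"
      by (simp only: B vector_add_component vector_scaleR_component)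
        (subst fp, simp add: algebra_simps scaleR_conv_of_real)
    moreover have "norm (x $ i) = 1"
      using x by (simp add: torus_def)
    ultimately show ?thesis
      using assms(6) by (simp only: norm_mult norm_of_real) simp
  qed
  define p q where "p = (\<chi> i. complex_of_real (norm ((A *v x) $ i)) * e $ i)"
    and "q = (\<chi> i. complex_of_real (norm ((?B *v z) $ i) - (norm ((A *v x) $ i) + b)) * z $ i)"
  have "Sigma_mat ?B z *v z = p + q - A *v e"
  proof (subst vec_eq_iff, intro allI)
    fix i
    have "(Sigma_mat ?B z *v z) $ i
        = complex_of_real (norm ((?B *v z) $ i)) * z $ i - (A *v z) $ i - b * z $ i"
      by (simp add: Sigma_mat_def matrix_vector_mult_diff_rdistrib Diag_vector_mult_nth
          cmod_vec_def B) (simp add: scaleR_conv_of_real)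
    also have "\<dots> = (p + q - A *v e) $ i"
      using fp[of i]
      by (simp add: p_def q_def e_def matrix_vector_mult_diff_distrib algebra_simps)
    finally show "(Sigma_mat ?B z *v z) $ i = (p + q - A *v e) $ i" .
  qed
  then have "rho ?B z = norm (p + q - A *v e)"
    by (simp add: rho_def)
  moreover have "norm p \<le> norm (p + q - A *v e) + norm q + norm (A *v e)"
    using norm_triangle_ineq4[of "p + q - A *v e" "q - A *v e"] norm_triangle_ineq4[of q "A *v e"]
    by simp
  moreover have "m * norm e \<le> norm p"
  proof -
    have "norm (m *\<^sub>R e) \<le> norm p"
      using m assms(5) by (intro norm_le_componentwise_cart) (simp add: p_def norm_mult mult_right_mono)
    then show ?thesis
      using assms(5) by simp
  qed
  \<comment> \<open>The modulus is 1-Lipschitz and the entries of \<open>z\<close> have modulus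
    1.\<close>
  moreover have "norm q \<le> norm (A *v e + b *\<^sub>R e)"
  proof (rule norm_le_componentwise_cart)
    fix i
    have "norm (z $ i) = 1"
      using assms(1) by (simp add: torus_def)
    then have "norm (q $ i) = \<bar>norm ((?B *v z) $ i) - norm ((?B *v x) $ i)\<bar>"
      by (simp add: q_def nB norm_mult del: of_real_diff of_real_add)
    also have "\<dots> \<le> norm ((?B *v z) $ i - (?B *v x) $ i)"
      by (rule norm_triangle_ineq3)
    also have "\<dots> = norm ((A *v e + b *\<^sub>R e) $ i)"
      unfolding B by (simp add: e_def matrix_vector_mult_diff_distrib algebra_simps)
    finally show "norm (q $ i) \<le> norm ((A *v e + b *\<^sub>R e) $ i)" .
  qed
  ultimately show ?thesis
    by (simp add: e_def)
qed

section \<open>Numerical bounds and conclusion\<close>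

theorem proposition3:
  fixes zstar z zhat :: "complex ^ 'n"
    and \<Delta> C Ct :: "complex ^ 'n ^ 'n"
    and \<alpha> :: real
  assumes "zstar \<in> torus"
    and "hermitian \<Delta>"
    and "\<forall>i. \<Delta> $ i $ i = 0"
    and "C = houter zstar zstar + \<Delta>"
    and "op_norm \<Delta> \<le> real CARD('n) powr (3/4) / 312"
    and "linf_norm (\<Delta> *v zstar) \<le> real CARD('n) / 24"
    and "ereal \<alpha> \<in> {4 ..< ereal (real CARD('n)) / ereal (op_norm \<Delta>)}"
      (* division in ereal: the upper end is infinity when op_norm is 0 *)
    and "Ct = C + (real CARD('n) / \<alpha>) *\<^sub>R mat 1"
    and "z \<in> torus"
    and "d2 z zstar \<le> sqrt (real CARD('n)) / 2"
    and "is_arg_max (\<lambda>w. Re (hdot w (C *v w))) (\<lambda>w. w \<in> torus) zhat"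
  shows "d2 z zhat \<le> 8 / real CARD('n) * rho Ct z"
proof -
  define n D where "n = real CARD('n)" and "D = op_norm \<Delta>"
  have n: "1 \<le> n"
    by (simp add: n_def Suc_leI)
  have D0: "0 \<le> D"
    by (simp add: D_def op_norm_nonneg)
  have "n powr (3/4) \<le> n powr 1"
    using n by (intro powr_mono) auto
  then have D1: "D \<le> n / 312"
    using assms(5) n by (simp add: D_def n_def)
  \<comment> \<open>The exponent 3/4 matters here: \<open>D * f\<close> is at most
    \<open>4 * D\<^sup>2 / sqrt n\<close>, which thus becomes a small multiple of \<open>n\<close>.
    It will bound the entries of \<open>\<Delta> *v (zhat - y)\<close>. Note 97344 = 312^2.\<close>
  have "D\<^sup>2 \<le> (n powr (3/4) / 312)\<^sup>2"
    using assms(5) D0 by (intro power_mono) (simp_all add: D_def n_def)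
  moreover have "(n powr (3/4))\<^sup>2 = n powr (1 + 1/2)"
    using n by (simp add: powr_powr flip: powr_numeral)
  moreover have "n powr (1 + 1/2) = n * sqrt n"
    using n by (simp only: powr_add powr_half_sqrt) simp
  ultimately have D2: "D\<^sup>2 \<le> n * sqrt n / 97344"
    by (simp add: power_divide)

  have zhat: "zhat \<in> torus"
    using assms(11) by (auto simp: is_arg_max_def)
  obtain a where a: "norm a = 1" "hdot zhat (a *s zstar) = complex_of_real (norm (hdot zhat zstar))"
    by (rule hdot_phase_alignment)
  define y where "y = a *s zstar"
  have y: "y \<in> torus"
    using a assms(1) by (simp add: y_def torus_scale)
  have al: "hdot zhat y = complex_of_real (norm (hdot zhat y))"
    using a by (simp add: y_def)
  have C: "C = houter y y + \<Delta>"
    by (simp add: assms(4) y_def houter_scale[OF a(1)])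
  define f where "f = norm (zhat - y)"
  have f: "sqrt n * f \<le> 4 * D"
    using maximizer_error_bound[OF y assms(2) C assms(11) al] by (simp add: n_def f_def D_def)
  have f0: "0 \<le> f"
    by (simp add: f_def)
  have sn: "0 < sqrt n" "sqrt n * sqrt n = n"
    using n by simp_all
  \<comment> \<open>4/312 = 1/78.\<close>
  have "sqrt n * f \<le> sqrt n * (sqrt n / 78)"
    using f D1 sn(2) by simp
  then have f1: "f \<le> sqrt n / 78"
    using sn(1) by (rule mult_left_le_imp_le)
  have "f\<^sup>2 \<le> (sqrt n / 78)\<^sup>2"
    using f1 f0 by (rule power_mono)
  then have f2: "f\<^sup>2 \<le> n / 6084"
    using sn by (simp add: power_divide)
  have "sqrt n * (D * f) \<le> 4 * D\<^sup>2"
    using mult_left_mono[OF f D0] by (simp add: power2_eq_square algebra_simps)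
  also have "\<dots> \<le> sqrt n * (n / 24336)"
    using D2 by (simp add: mult.commute)
  finally have Df: "D * f \<le> n / 24336"
    using sn by simp

  obtain c where c: "norm c = 1" "hdot zhat (c *s z) = complex_of_real (norm (hdot zhat z))"
    by (rule hdot_phase_alignment)
  have c0: "c \<noteq> 0"
    using c by auto
  define z' where "z' = c *s z"
  have z': "z' \<in> torus"
    using c assms(9) by (simp add: z'_def torus_scale)
  have al': "hdot zhat z' = complex_of_real (norm (hdot zhat z'))"
    using c by (simp add: z'_def norm_mult hdot_scale_right)
  define e where "e = z' - zhat"
  have "d2 z zhat \<le> norm (z - inverse c *s zhat)"
    using c by (intro d2_le_norm) (simp add: norm_inverse)
  also have "\<dots> = norm (c *s (z - inverse c *s zhat))"
    by (simp only: norm_scale_vec c mult_1)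
  also have "c *s (z - inverse c *s zhat) = e"
    using c0 by (simp add: e_def z'_def vec_eq_iff algebra_simps)
  finally have d2e: "d2 z zhat \<le> norm e" .

  \<comment> \<open>Up to a common phase, \<open>z'\<close> is the rotation of \<open>z\<close>
    nearest to \<open>zhat\<close>, so it is compared with the rotation \<open>b *s z\<close> that
    realizes \<open>d2 z zstar\<close> against \<open>y\<close>.\<close>
  have e_le: "norm e \<le> sqrt n / 2 + f"
  proof -
    obtain \<theta> where \<theta>: "d2 z zstar = norm (z - cis \<theta> *s zstar)"
      using d2_attained(1) by blast
    define b where "b = a * cis (- \<theta>)"
    have b: "norm b = 1"
      by (simp add: b_def norm_mult a)
    have "y = b *s (cis \<theta> *s zstar)"
      by (simp add: y_def b_def vector_smult_assoc mult.assoc cis_mult)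
    then have "norm (b *s z - y) = norm (b *s (z - cis \<theta> *s zstar))"
      by (simp only: vector_ssub_ldistrib)
    also have "\<dots> = d2 z zstar"
      by (simp only: norm_scale_vec b mult_1 \<theta>)
    finally have 1: "norm (b *s z - y) \<le> sqrt n / 2"
      using assms(10) by (simp add: n_def)
    have "norm e \<le> norm (zhat - (b / c) *s z')"
      using norm_aligned_diff_le[OF zhat z' al', of "b / c"] b c
      by (simp add: e_def norm_minus_commute norm_divide)
    also have "(b / c) *s z' = b *s z"
      using c0 by (simp add: z'_def vector_smult_assoc)
    also have "norm (zhat - b *s z) \<le> f + norm (b *s z - y)"
      using norm_triangle_ineq4[of "zhat - y" "b *s z - y"] by (simp add: f_def)
    finally show ?thesis
      using 1 by simp
  qed

  \<comment> \<open>The constant: \<open>norm e / 2 + f\<close> is at most sqrt n / 4 plus 3/2 of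
    sqrt n / 78, whence 1/4 + 1/52; \<open>\<Delta>\<close> adds 1/312. The sum 85/312 is just below
    109/400.\<close>
  have Ce: "norm (C *v e) \<le> 109/400 * n * norm e"
  proof -
    have "norm (hdot y e) \<le> norm (hdot zhat e) + norm (hdot (zhat - y) e)"
      using norm_triangle_ineq4[of "hdot zhat e" "hdot (zhat - y) e"] by (simp add: hdot_diff_left)
    moreover have "norm (hdot (zhat - y) e) \<le> f * norm e"
      unfolding f_def by (rule norm_hdot_le)
    \<comment> \<open>Alignment makes \<open>hdot zhat e\<close> the real number
      \<open>s - n\<close>, so it is quadratic in \<open>norm e\<close>.\<close>
    moreover have "norm (hdot zhat e) = (norm e)\<^sup>2 / 2"
    proof -
      define s where "s = norm (hdot zhat z')"
      have "hdot zhat e = complex_of_real (s - n)"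
        using al' norm2_torus[OF zhat] by (simp add: e_def hdot_diff_right hdot_self s_def n_def)
      moreover have "(norm e)\<^sup>2 = 2 * n - 2 * s"
        using norm2_diff_torus[OF zhat z'] al'
        by (metis Re_complex_of_real e_def n_def norm_minus_commute s_def)
      ultimately show ?thesis
        using zero_le_power2[of "norm e"] by (simp only: norm_of_real) simp
    qed
    ultimately have "norm (hdot y e) \<le> norm e * (norm e / 2 + f)"
      by (simp add: power2_eq_square algebra_simps)
    also have "\<dots> \<le> norm e * ((1/4 + 1/52) * sqrt n)"
      using e_le f1 by (intro mult_left_mono) auto
    finally have "norm (hdot y e) * sqrt n \<le> norm e * ((1/4 + 1/52) * sqrt n) * sqrt n"
      using sn by (intro mult_right_mono) auto
    then have 1: "norm (hdot y e) * sqrt n \<le> (1/4 + 1/52) * n * norm e"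
      by (simp only: mult.assoc sn(2)) (simp add: mult_ac)
    have "norm (C *v e) \<le> norm (hdot y e *s y) + norm (\<Delta> *v e)"
      unfolding C matrix_vector_mult_add_rdistrib houter_vector_mult by (rule norm_triangle_ineq)
    also have "\<dots> \<le> norm (hdot y e) * sqrt n + D * norm e"
      using norm_matrix_vector_le[of \<Delta> e] by (simp add: norm_scale_vec norm_torus[OF y] n_def D_def)
    also have "\<dots> \<le> (1/4 + 1/52) * n * norm e + n / 312 * norm e"
      using 1 D1 by (intro add_mono mult_right_mono) auto
    also have "\<dots> \<le> 109/400 * n * norm e"
      using n mult_nonneg_nonneg[of n "norm e"] by (simp add: algebra_simps)
    finally show ?thesis .
  qed

  have fp: "(C *v zhat) $ i = complex_of_real (norm ((C *v zhat) $ i)) * zhat $ i" for i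
  proof (rule maximizer_fixed_point[OF _ _ assms(11)])
    show "hermitian C"
      unfolding assms(4) by (rule hermitian_houter_add[OF assms(2)])
    show "0 \<le> Re (C $ i $ i)"
      using assms(3) by (simp add: assms(4) houter_def)
  qed
  \<comment> \<open>The rank-one part contributes n - f^2/2. The sup-norm hypothesis concerns
    \<open>zstar\<close>, hence also its rotation \<open>y\<close>; passing to \<open>zhat\<close>
    costs \<open>D * f\<close>. The total loss, about n/24, stays below n/20.\<close>
  have m: "19/20 * n \<le> norm ((C *v zhat) $ i)" for i
  proof -
    have s: "n - f\<^sup>2 / 2 = norm (hdot y zhat)"
    proof -
      have "Re (hdot zhat y) = norm (hdot zhat y)"
        by (subst al) simp
      moreover have "norm (hdot zhat y) = norm (hdot y zhat)"
        by (metis cnj_hdot complex_mod_cnj)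
      ultimately show ?thesis
        using norm2_diff_torus[OF zhat y] by (simp add: f_def n_def diff_divide_distrib)
    qed
    have yi: "norm (y $ i) = 1"
      using y by (simp add: torus_def)
    have "norm ((\<Delta> *v zhat) $ i) \<le> norm ((\<Delta> *v y) $ i) + norm ((\<Delta> *v (zhat - y)) $ i)"
      using norm_triangle_ineq[of "(\<Delta> *v y) $ i" "(\<Delta> *v (zhat - y)) $ i"]
      by (simp add: matrix_vector_mult_diff_distrib)
    also have "norm ((\<Delta> *v y) $ i) = norm ((\<Delta> *v zstar) $ i)"
      by (simp add: y_def vector_scalar_commute norm_mult a)
    also have "\<dots> \<le> n / 24"
      using norm_nth_le_linf_norm[of "\<Delta> *v zstar" i] assms(6) by (simp add: n_def)
    also have "norm ((\<Delta> *v (zhat - y)) $ i) \<le> D * f"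
      using Finite_Cartesian_Product.norm_nth_le[of "\<Delta> *v (zhat - y)" i] norm_matrix_vector_le[of \<Delta> "zhat - y"]
      by (simp add: D_def f_def)
    finally have 1: "norm ((\<Delta> *v zhat) $ i) \<le> n / 24 + n / 24336"
      using Df by simp
    have "(C *v zhat) $ i = hdot y zhat * y $ i + (\<Delta> *v zhat) $ i"
      by (simp add: C matrix_vector_mult_add_rdistrib houter_vector_mult)
    then have "norm (hdot y zhat * y $ i) \<le> norm ((C *v zhat) $ i) + norm ((\<Delta> *v zhat) $ i)"
      using norm_triangle_ineq4[of "(C *v zhat) $ i" "(\<Delta> *v zhat) $ i"] by simp
    then have "n - f\<^sup>2 / 2 \<le> norm ((C *v zhat) $ i) + norm ((\<Delta> *v zhat) $ i)"
      by (simp add: s norm_mult yi)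
    with 1 f2 n show ?thesis
      by linarith
  qed

  have "4 \<le> \<alpha>"
    using assms(7) by simp
  define b where "b = n / \<alpha>"
  have b: "0 \<le> b" "b \<le> n / 4"
    using \<open>4 \<le> \<alpha>\<close> n by (auto simp: b_def field_simps)
  have "norm (C *v e + b *\<^sub>R e) \<le> norm (C *v e) + b * norm e"
    using norm_triangle_ineq[of "C *v e" "b *\<^sub>R e"] b by simp
  also have "b * norm e \<le> n / 4 * norm e"
    using b by (intro mult_right_mono) auto
  finally have Cte: "norm (C *v e + b *\<^sub>R e) \<le> norm (C *v e) + n / 4 * norm e"
    by simp
  have "rho Ct z = rho (C + b *\<^sub>R mat 1) z'"
    by (simp add: assms(8) b_def n_def z'_def rho_scale[OF c(1)])
  moreover have "19/20 * n * norm e - norm (C *v e) - norm (C *v e + b *\<^sub>R e)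
      \<le> rho (C + b *\<^sub>R mat 1) z'"
    unfolding e_def by (rule rho_ge[OF z' fp zhat m]) (use n b in auto)
  moreover have "0 \<le> n * norm e"
    using n by simp
  \<comment> \<open>19/20 - 2 * 109/400 - 1/4 = 31/200, which exceeds 1/8.\<close>
  ultimately have "n / 8 * norm e \<le> rho Ct z"
    using Ce Cte unfolding mult.assoc times_divide_eq_left by linarith
  then have "norm e \<le> 8 / n * rho Ct z"
    using n by (simp add: field_simps)
  with d2e show ?thesis
    by (simp add: n_def)
qed

end
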